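(* Let $G$ be a graph with $|V(G)|=p$, $\alpha(G)\le \frac{p}{4.1}$ and girth at least $6$. Let $q$ be an integer with $q\ge 2^{p-1}p^2$ and let $c=4q+2$. Then $\chi(G[K_q])>c$ and $\chi\big(K_c^{G[K_q]}\big)>c$.
   Context: For a positive integer $c$, $[c]=\{1,\dots,c\}$. $\alpha(G)$ is the independence number of $G$. $G[K_q]$ is the graph with vertex set $V(G)\times[q]$ in which $(x,i)$ and $(y,j)$ are adjacent iff either $xy\in E(G)$, or $x=y$ and $i\ne j$. For a graph $F$ and positive integer $c$, the exponential graph $K_c^F$ has as vertices all maps $f:V(F)\to[c]$, with $f$ adjacent to $g$ iff for every edge $xy\in E(F)$ we have $f(x)\ne g(y)$ and $f(y)\ne g(x)$ (in particular $f$ has a loop iff $f$ is a proper colouring of $F$). *)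

theory Defs
  imports Main "HOL-Library.FuncSet" "HOL-Library.Extended_Nat"
begin

text \<open>A graph is given by a vertex set V and an adjacency relation E (only
  its restriction to V matters). A finite simple graph additionally has V finite
  and E symmetric and irreflexive on V. Exponential graphs may have loops.\<close>

definition simple_graph :: "'a set \<Rightarrow> ('a \<Rightarrow> 'a \<Rightarrow> bool) \<Rightarrow> bool" where
  "simple_graph V E \<longleftrightarrow> finite V \<and> (\<forall>x\<in>V. \<forall>y\<in>V. E x y \<longrightarrow> E y x) \<and> (\<forall>x\<in>V. \<not> E x x)"

text \<open>Proper colouring with colours in [c] = {1..c}; a loop forbids any proper colouring.\<close>
definition colourable :: "'a set \<Rightarrow> ('a \<Rightarrow> 'a \<Rightarrow> bool) \<Rightarrow> nat \<Rightarrow> bool" where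
  "colourable V E c \<longleftrightarrow> (\<exists>f. (\<forall>x\<in>V. f x \<in> {1..c}) \<and> (\<forall>x\<in>V. \<forall>y\<in>V. E x y \<longrightarrow> f x \<noteq> f y))"

text \<open>Chromatic number (infinite if no proper colouring with finitely many colours exists).\<close>
definition chromatic_number :: "'a set \<Rightarrow> ('a \<Rightarrow> 'a \<Rightarrow> bool) \<Rightarrow> enat" where
  "chromatic_number V E = Inf {enat k | k. colourable V E k}"

definition independent_set :: "'a set \<Rightarrow> ('a \<Rightarrow> 'a \<Rightarrow> bool) \<Rightarrow> 'a set \<Rightarrow> bool" where
  "independent_set V E S \<longleftrightarrow> S \<subseteq> V \<and> (\<forall>x\<in>S. \<forall>y\<in>S. \<not> E x y)"

definition independence_number :: "'a set \<Rightarrow> ('a \<Rightarrow> 'a \<Rightarrow> bool) \<Rightarrow> nat" where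
  "independence_number V E = Max {card S | S. independent_set V E S}"

definition is_cycle :: "'a set \<Rightarrow> ('a \<Rightarrow> 'a \<Rightarrow> bool) \<Rightarrow> 'a list \<Rightarrow> bool" where
  "is_cycle V E xs \<longleftrightarrow> length xs \<ge> 3 \<and> distinct xs \<and> set xs \<subseteq> V \<and>
     (\<forall>i < length xs - 1. E (xs ! i) (xs ! Suc i)) \<and> E (last xs) (hd xs)"

text \<open>Girth: length of a shortest cycle (infinite for forests).\<close>
definition girth :: "'a set \<Rightarrow> ('a \<Rightarrow> 'a \<Rightarrow> bool) \<Rightarrow> enat" where
  "girth V E = Inf {enat (length xs) | xs. is_cycle V E xs}"

definition lex_Kq_vertices :: "'a set \<Rightarrow> nat \<Rightarrow> ('a \<times> nat) set" where
  "lex_Kq_vertices V q = V \<times> {1..q}"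

definition lex_Kq_edge :: "('a \<Rightarrow> 'a \<Rightarrow> bool) \<Rightarrow> ('a \<times> nat) \<Rightarrow> ('a \<times> nat) \<Rightarrow> bool" where
  "lex_Kq_edge E = (\<lambda>(x, i) (y, j). E x y \<or> (x = y \<and> i \<noteq> j))"

definition exp_vertices :: "nat \<Rightarrow> 'a set \<Rightarrow> ('a \<Rightarrow> nat) set" where
  "exp_vertices c VF = VF \<rightarrow>\<^sub>E {1..c}"

definition exp_edge :: "'a set \<Rightarrow> ('a \<Rightarrow> 'a \<Rightarrow> bool) \<Rightarrow> ('a \<Rightarrow> nat) \<Rightarrow> ('a \<Rightarrow> nat) \<Rightarrow> bool" where
  "exp_edge VF EF f g \<longleftrightarrow> (\<forall>x\<in>VF. \<forall>y\<in>VF. EF x y \<longrightarrow> f x \<noteq> g y \<and> f y \<noteq> g x)"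

end

theory Submission
  imports Defs
begin

text \<open>
  If \<open>G[K\<^sub>q]\<close> had a proper \<open>c\<close>-colouring, then every colour class would project injectively to an
  independent set of \<open>G\<close>, so \<open>p q \<le> c \<alpha>(G) \<le> c p / 4.1\<close>, which fails for large \<open>q\<close>.

  Let \<open>\<Psi>\<close> be a proper \<open>c\<close>-colouring of the exponential graph. Its constant maps form a clique, so
  one may assume that \<open>\<Psi>\<close> maps the constant map \<open>i\<close> to \<open>i\<close>; then \<open>\<Psi> f\<close> is always a value of \<open>f\<close>.
  Call \<open>b\<close> robust at \<open>v\<close> if every map that is constant on the copies of \<open>K\<^sub>q\<close> and has colour \<open>b\<close>
  takes the value \<open>b\<close> on the closed neighbourhood \<open>N[v]\<close>. A counting argument yields a vertex \<open>v\<close>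
  at which all but \<open>p\<^sup>3\<close> colours are robust. As the girth is at least 6, the vertices at distance 1
  from \<open>v\<close> are independent, and so are those at distance 0 or 2. Hence the maps \<open>\<mu>\<^sub>t\<close> with
  \<open>\<mu>\<^sub>t(x,i) = i\<close> at distance 0 or 2, \<open>q + i\<close> at distance 1, and \<open>t\<close> elsewhere form a clique for
  \<open>2 q < t \<le> c\<close>. The clique has more than \<open>2 q\<close> vertices, so \<open>\<Psi> \<mu>\<^sub>t = t\<close> for some \<open>t\<close>. For a robust
  colour \<open>z > 2 q\<close>, \<open>z \<noteq> t\<close>, the map that is \<open>t\<close> on \<open>N[v]\<close> and \<open>z\<close> elsewhere cannot have colour \<open>z\<close>,
  so it has colour \<open>t\<close>; but it is adjacent to \<open>\<mu>\<^sub>t\<close>.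
\<close>

section \<open>Chromatic number and colour classes\<close>

lemma colourable_mono:
  assumes "colourable V E k" and "k \<le> c"
  shows "colourable V E c"
proof -
  obtain f where "\<forall>x\<in>V. f x \<in> {1..k}" "\<forall>x\<in>V. \<forall>y\<in>V. E x y \<longrightarrow> f x \<noteq> f y"
    using assms(1) unfolding colourable_def by blast
  with assms(2) show ?thesis
    unfolding colourable_def by (intro exI[of _ f]) fastforce
qed

lemma less_chromatic_numberI:
  assumes "\<not> colourable V E c"
  shows "chromatic_number V E > enat c"
proof -
  \<comment> \<open>The bound \<open>Suc c\<close> keeps the inequality strict when passing to the
    infimum.\<close>
  have "enat (Suc c) \<le> chromatic_number V E"
    unfolding chromatic_number_def
  proof (rule Inf_greatest)
    fix x assume "x \<in> {enat k | k. colourable V E k}"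
    then obtain k where "x = enat k" "colourable V E k" by blast
    with assms colourable_mono show "enat (Suc c) \<le> x"
      by (metis enat_ord_simps(1) not_less_eq_eq)
  qed
  then show ?thesis
    by (metis enat_ord_simps(2) lessI less_le_trans)
qed

lemma card_independent_set_le:
  assumes "finite V" and "independent_set V E S"
  shows "card S \<le> independence_number V E"
proof -
  have "{card S | S. independent_set V E S} \<subseteq> card ` Pow V"
    unfolding independent_set_def by blast
  then have "finite {card S | S. independent_set V E S}"
    using assms(1) finite_subset by blast
  then show ?thesis
    unfolding independence_number_def using assms(2) by (auto intro: Max_ge)
qed

lemma colourable_lex_Kq_imp_le:
  assumes "finite V" and "colourable (lex_Kq_vertices V q) (lex_Kq_edge E) c"
  shows "card V * q \<le> c * independence_number V E"
proof -
  define F where "F = lex_Kq_vertices V q"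
  obtain f where range: "\<And>z. z \<in> F \<Longrightarrow> f z \<in> {1..c}"
    and proper: "\<And>y z. y \<in> F \<Longrightarrow> z \<in> F \<Longrightarrow> lex_Kq_edge E y z \<Longrightarrow> f y \<noteq> f z"
    using assms(2) unfolding colourable_def F_def by blast
  have class_le: "card {z \<in> F. f z = k} \<le> independence_number V E" for k
  proof -
    let ?C = "{z \<in> F. f z = k}"
    have no_edge: "\<not> lex_Kq_edge E y z" if "y \<in> ?C" "z \<in> ?C" for y z
      using proper[of y z] that by auto
    have "inj_on fst ?C"
    proof (rule inj_onI)
      fix y z assume "y \<in> ?C" "z \<in> ?C" "fst y = fst z"
      with no_edge[of y z] show "y = z"
        by (auto simp: lex_Kq_edge_def split: prod.splits)
    qed
    then have "card ?C = card (fst ` ?C)" by (simp add: card_image)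
    moreover have "independent_set V E (fst ` ?C)"
      unfolding independent_set_def
    proof (intro conjI ballI)
      fix x y assume "x \<in> fst ` ?C" "y \<in> fst ` ?C"
      then obtain i j where "(x, i) \<in> ?C" "(y, j) \<in> ?C" by force
      from no_edge[OF this] show "\<not> E x y" by (simp add: lex_Kq_edge_def)
    qed (auto simp: F_def lex_Kq_vertices_def)
    ultimately show ?thesis
      using card_independent_set_le[OF assms(1), of E "fst ` ?C"] by simp
  qed
  have "card V * q = card F" by (simp add: F_def lex_Kq_vertices_def card_cartesian_product)
  also have "card F = card (\<Union>k\<in>{1..c}. {z \<in> F. f z = k})"
    using range by (intro arg_cong[of _ _ card]) blast
  also have "\<dots> \<le> (\<Sum>k\<in>{1..c}. card {z \<in> F. f z = k})"
    by (rule card_UN_le) simp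
  also have "\<dots> \<le> (\<Sum>k\<in>{1..c}. independence_number V E)"
    by (rule sum_mono) (rule class_le)
  finally show ?thesis by simp
qed

section \<open>Short cycles excluded by the girth\<close>

lemma girth_le_length:
  assumes "is_cycle V E xs"
  shows "girth V E \<le> enat (length xs)"
  unfolding girth_def using assms by (auto intro: Inf_lower)

lemma girth_no_triangle:
  assumes "girth V E \<ge> 6" and "{a, b, d} \<subseteq> V" and "distinct [a, b, d]"
  shows "\<not> (E a b \<and> E b d \<and> E d a)"
proof
  assume "E a b \<and> E b d \<and> E d a"
  then have "is_cycle V E [a, b, d]"
    using assms(2,3) by (auto simp: is_cycle_def nth_Cons less_Suc_eq numeral_eq_Suc split: nat.splits)
  then have "6 \<le> enat (length [a, b, d])"
    using girth_le_length assms(1) order_trans by blast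
  then show False by (simp add: numeral_eq_enat)
qed

lemma girth_no_pentagon:
  assumes "girth V E \<ge> 6" and "{a, b, d, e, f} \<subseteq> V" and "distinct [a, b, d, e, f]"
  shows "\<not> (E a b \<and> E b d \<and> E d e \<and> E e f \<and> E f a)"
proof
  assume "E a b \<and> E b d \<and> E d e \<and> E e f \<and> E f a"
  then have "is_cycle V E [a, b, d, e, f]"
    using assms(2,3) by (auto simp: is_cycle_def nth_Cons less_Suc_eq numeral_eq_Suc split: nat.splits)
  then have "6 \<le> enat (length [a, b, d, e, f])"
    using girth_le_length assms(1) order_trans by blast
  then show False by (simp add: numeral_eq_enat)
qed

section \<open>Counting transversals\<close>

lemma card_PiE_two_fixed_le:
  assumes "finite V" and "v \<in> V" and "x \<in> V" and "x \<noteq> v"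
    and "\<And>u. u \<in> V \<Longrightarrow> finite (B u)" and "\<And>u. u \<in> V \<Longrightarrow> card (B u) = m"
  shows "card {\<phi> \<in> PiE V B. \<phi> v = b \<and> \<phi> x = d} \<le> m ^ (card V - 2)"
proof -
  let ?C = "\<lambda>u. if u = v then {b} else if u = x then {d} else B u"
  have "card {\<phi> \<in> PiE V B. \<phi> v = b \<and> \<phi> x = d} \<le> card (PiE V ?C)"
    using assms(1,5) by (intro card_mono finite_PiE) (auto simp: PiE_iff extensional_def)
  also have "\<dots> = (\<Prod>u\<in>V. card (?C u))"
    using assms(1) by (rule card_PiE)
  also have "\<dots> = (\<Prod>u\<in>V - {v, x}. card (?C u))"
    using assms(1) by (intro prod.mono_neutral_right) auto
  also have "\<dots> = (\<Prod>u\<in>V - {v, x}. m)"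
    using assms(6) by (intro prod.cong) auto
  also have "\<dots> = m ^ (card V - 2)"
    using assms(2-4) by (simp add: card_Diff_subset numeral_2_eq_2)
  finally show ?thesis .
qed

text \<open>Union bound: once every \<open>B v\<close> is cut down to m = p^3 + 1 elements, there
  are m^p transversals, and those violating the condition at some pair v, x number at most p^3
  m^(p-1).\<close>

lemma ex_transversal_avoiding:
  fixes B :: "'a \<Rightarrow> 'b set"
  assumes fin: "finite V"
    and large: "\<And>v. v \<in> V \<Longrightarrow> card (B v) > card V ^ 3"
    and D: "\<And>v b. v \<in> V \<Longrightarrow> b \<in> B v \<Longrightarrow> finite (D v b) \<and> card (D v b) \<le> card V"
  shows "\<exists>\<phi>\<in>PiE V B. \<forall>v\<in>V. \<forall>x\<in>V. x \<noteq> v \<longrightarrow> \<phi> x \<notin> D v (\<phi> v)"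
proof -
  define p m where "p = card V" and "m = Suc (p ^ 3)"
  have "\<exists>C. C \<subseteq> B v \<and> finite C \<and> card C = m" if "v \<in> V" for v
    using large[OF that] obtain_subset_with_card_n[of m "B v"]
    unfolding m_def p_def by (metis Suc_leI)
  then obtain C where C: "\<And>v. v \<in> V \<Longrightarrow> C v \<subseteq> B v" "\<And>v. v \<in> V \<Longrightarrow> finite (C v)"
      "\<And>v. v \<in> V \<Longrightarrow> card (C v) = m"
    by metis
  let ?cell = "\<lambda>v x b d. {\<phi> \<in> PiE V C. \<phi> v = b \<and> \<phi> x = d}"
  let ?bad = "\<Union>v\<in>V. \<Union>x\<in>V - {v}. \<Union>b\<in>C v. \<Union>d\<in>D v b. ?cell v x b d"
  have card_total: "card (PiE V C) = m ^ p"
    using C(3) by (simp add: card_PiE fin p_def)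
  have card_bad: "card ?bad < m ^ p"
  \<comment> \<open>Here \<open>p - 2\<close> is truncated, so the count below would fail; but no
    pair of distinct vertices exists.\<close>
  proof (cases "p < 2")
    case True
    then have "card V \<le> 1" by (simp add: p_def)
    then have "V - {v} = {}" if "v \<in> V" for v
      using that fin by (metis card_le_Suc0_iff_eq One_nat_def Diff_eq_empty_iff singletonI subsetI)
    then have "?bad = {}" by blast
    then have "card ?bad = 0" by (simp only: card.empty)
    moreover have "0 < m ^ p" by (simp add: m_def)
    ultimately show ?thesis by linarith
  next
    case False
    have "card ?bad \<le> (\<Sum>v\<in>V. card (\<Union>x\<in>V - {v}. \<Union>b\<in>C v. \<Union>d\<in>D v b. ?cell v x b d))"
      by (rule card_UN_le[OF fin])
    also have "\<dots> \<le> (\<Sum>v\<in>V. p * (m * (p * m ^ (p - 2))))"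
    proof (rule sum_mono)
      fix v assume v: "v \<in> V"
      have "card (\<Union>x\<in>V - {v}. \<Union>b\<in>C v. \<Union>d\<in>D v b. ?cell v x b d)
          \<le> (\<Sum>x\<in>V - {v}. card (\<Union>b\<in>C v. \<Union>d\<in>D v b. ?cell v x b d))"
        using fin by (intro card_UN_le) simp
      also have "\<dots> \<le> (\<Sum>x\<in>V - {v}. m * (p * m ^ (p - 2)))"
      proof (rule sum_mono)
        fix x assume x: "x \<in> V - {v}"
        have "card (\<Union>b\<in>C v. \<Union>d\<in>D v b. ?cell v x b d)
            \<le> (\<Sum>b\<in>C v. card (\<Union>d\<in>D v b. ?cell v x b d))"
          using C(2)[OF v] by (rule card_UN_le)
        also have "\<dots> \<le> (\<Sum>b\<in>C v. p * m ^ (p - 2))"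
        proof (rule sum_mono)
          fix b assume b: "b \<in> C v"
          have Db: "finite (D v b)" "card (D v b) \<le> p"
            using D[OF v] C(1)[OF v] b unfolding p_def by blast+
          have "card (\<Union>d\<in>D v b. ?cell v x b d) \<le> (\<Sum>d\<in>D v b. card (?cell v x b d))"
            using Db(1) by (rule card_UN_le)
          also have "\<dots> \<le> (\<Sum>d\<in>D v b. m ^ (p - 2))"
            unfolding p_def using x C v fin by (intro sum_mono card_PiE_two_fixed_le) auto
          also have "\<dots> \<le> p * m ^ (p - 2)" using Db(2) by simp
          finally show "card (\<Union>d\<in>D v b. ?cell v x b d) \<le> p * m ^ (p - 2)" .
        qed
        finally show "card (\<Union>b\<in>C v. \<Union>d\<in>D v b. ?cell v x b d) \<le> m * (p * m ^ (p - 2))"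
          using C(3)[OF v] by simp
      qed
      also have "\<dots> = card (V - {v}) * (m * (p * m ^ (p - 2)))" by simp
      also have "\<dots> \<le> p * (m * (p * m ^ (p - 2)))"
        unfolding p_def using fin by (intro mult_right_mono card_mono) auto
      finally show "card (\<Union>x\<in>V - {v}. \<Union>b\<in>C v. \<Union>d\<in>D v b. ?cell v x b d)
          \<le> p * (m * (p * m ^ (p - 2)))" .
    qed
    \<comment> \<open>The factors p come from the choices of v, x and d, the factor m from
      b.\<close>
    also have "\<dots> = p ^ 3 * (m * m ^ (p - 2))" by (simp add: p_def power3_eq_cube)
    also have "\<dots> < m * (m * m ^ (p - 2))" by (simp add: m_def)
    also have "\<dots> = m ^ p"
      using False by (metis add_2_eq_Suc le_add_diff_inverse not_less power_Suc)
    finally show ?thesis .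
  qed
  have "\<exists>\<phi>\<in>PiE V C. \<phi> \<notin> ?bad"
  proof (rule ccontr)
    assume "\<not> ?thesis"
    then have "PiE V C \<subseteq> ?bad" by blast
    moreover have "?bad \<subseteq> PiE V C" by blast
    ultimately have "?bad = PiE V C" by (rule subset_antisym[rotated])
    then have "card ?bad = m ^ p" by (simp only: card_total)
    with card_bad show False by linarith
  qed
  then obtain \<phi> where \<phi>: "\<phi> \<in> PiE V C" "\<phi> \<notin> ?bad" by (elim bexE)
  show ?thesis
  proof (intro bexI ballI impI)
    show "\<phi> \<in> PiE V B" using \<phi>(1) C(1) by (auto simp: PiE_iff)
    show "\<phi> x \<notin> D v (\<phi> v)" if "v \<in> V" "x \<in> V" "x \<noteq> v" for v x
      using \<phi> that by (auto simp: PiE_iff)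
  qed
qed

section \<open>Colourings of the exponential graph that fix the constant maps\<close>

locale normalised_exp_colouring =
  fixes V :: "'a set" and E :: "'a \<Rightarrow> 'a \<Rightarrow> bool" and q c :: nat
    and \<Psi> :: "('a \<times> nat \<Rightarrow> nat) \<Rightarrow> nat"
  assumes finite_V: "finite V"
    and E_sym: "x \<in> V \<Longrightarrow> y \<in> V \<Longrightarrow> E x y \<Longrightarrow> E y x"
    and \<Psi>_range: "f \<in> exp_vertices c (lex_Kq_vertices V q) \<Longrightarrow> \<Psi> f \<in> {1..c}"
    and \<Psi>_proper: "f \<in> exp_vertices c (lex_Kq_vertices V q) \<Longrightarrow>
      g \<in> exp_vertices c (lex_Kq_vertices V q) \<Longrightarrow>
      exp_edge (lex_Kq_vertices V q) (lex_Kq_edge E) f g \<Longrightarrow> \<Psi> f \<noteq> \<Psi> g"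
    and \<Psi>_const: "i \<in> {1..c} \<Longrightarrow> \<Psi> (\<lambda>z\<in>lex_Kq_vertices V q. i) = i"
begin

text \<open>A constant map whose value f omits is adjacent to f, so f cannot share its
  colour.\<close>

lemma \<Psi>_in_image:
  assumes "f \<in> exp_vertices c (lex_Kq_vertices V q)"
  shows "\<Psi> f \<in> f ` lex_Kq_vertices V q"
proof (rule ccontr)
  let ?F = "lex_Kq_vertices V q"
  let ?k = "\<lambda>z\<in>?F. \<Psi> f"
  assume "\<Psi> f \<notin> f ` ?F"
  then have "exp_edge ?F (lex_Kq_edge E) ?k f"
    by (auto simp: exp_edge_def)
  moreover have "?k \<in> exp_vertices c ?F"
    using \<Psi>_range[OF assms] by (simp add: exp_vertices_def)
  ultimately show False
    using \<Psi>_proper[OF _ assms] \<Psi>_const[OF \<Psi>_range[OF assms]] by blast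
qed

definition fibre_const :: "('a \<Rightarrow> nat) \<Rightarrow> 'a \<times> nat \<Rightarrow> nat" where
  "fibre_const \<phi> = (\<lambda>z\<in>lex_Kq_vertices V q. \<phi> (fst z))"

lemma fibre_const_in_exp_vertices:
  assumes "\<phi> \<in> V \<rightarrow> {1..c}"
  shows "fibre_const \<phi> \<in> exp_vertices c (lex_Kq_vertices V q)"
  using assms by (auto simp: fibre_const_def exp_vertices_def lex_Kq_vertices_def)

lemma \<Psi>_fibre_const_in_image:
  assumes "\<phi> \<in> V \<rightarrow> {1..c}"
  shows "\<Psi> (fibre_const \<phi>) \<in> \<phi> ` V"
  using \<Psi>_in_image[OF fibre_const_in_exp_vertices[OF assms]]
  by (auto simp: fibre_const_def lex_Kq_vertices_def)

text \<open>Maps of equal colour are not adjacent, so they clash along an edge of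
  \<open>G[K\<^sub>q]\<close>, whose ends lie over equal or adjacent vertices of G.\<close>

lemma \<Psi>_fibre_const_eq_imp:
  assumes "\<phi> \<in> V \<rightarrow> {1..c}" and "\<psi> \<in> V \<rightarrow> {1..c}"
    and "\<Psi> (fibre_const \<phi>) = \<Psi> (fibre_const \<psi>)"
  obtains x y where "x \<in> V" "y \<in> V" "y = x \<or> E x y" "\<phi> x = \<psi> y"
proof -
  have "\<not> exp_edge (lex_Kq_vertices V q) (lex_Kq_edge E) (fibre_const \<phi>) (fibre_const \<psi>)"
    using \<Psi>_proper assms fibre_const_in_exp_vertices by blast
  then obtain x i y j where "(x, i) \<in> V \<times> {1..q}" "(y, j) \<in> V \<times> {1..q}" "x = y \<or> E x y"
    "\<phi> x = \<psi> y \<or> \<phi> y = \<psi> x"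
    unfolding exp_edge_def lex_Kq_vertices_def fibre_const_def lex_Kq_edge_def by fastforce
  then show thesis using that[of x y] that[of y x] E_sym by blast
qed

definition robust :: "'a \<Rightarrow> nat \<Rightarrow> bool" where
  "robust v b \<longleftrightarrow> (\<forall>\<phi>\<in>V \<rightarrow> {1..c}. \<Psi> (fibre_const \<phi>) = b \<longrightarrow>
     (\<exists>w\<in>V. (w = v \<or> E v w) \<and> \<phi> w = b))"

text \<open>Otherwise, for each v and each b not robust at v, choose a map \<open>\<psi> v b\<close>
  of colour b avoiding b on N[v]. Take a transversal \<phi> of nonrobust colours whose values off v
  miss those of \<open>\<psi> v (\<phi> v)\<close>. For some v, \<phi> has colour
  \<open>\<phi> v\<close>, hence must clash with \<open>\<psi> v (\<phi> v)\<close>: off v this is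
  ruled out by the choice of \<phi>, at v by the avoidance on N[v].\<close>

lemma ex_vertex_few_nonrobust:
  "\<exists>v\<in>V. card {b \<in> {1..c}. \<not> robust v b} \<le> card V ^ 3"
proof (rule ccontr)
  define B where "B v = {b \<in> {1..c}. \<not> robust v b}" for v
  define W where "W v b \<psi> \<longleftrightarrow> \<psi> \<in> V \<rightarrow> {1..c} \<and> \<Psi> (fibre_const \<psi>) = b \<and>
    (\<forall>w\<in>V. w = v \<or> E v w \<longrightarrow> \<psi> w \<noteq> b)" for v b \<psi>
  assume "\<not> ?thesis"
  then have large: "card (B v) > card V ^ 3" if "v \<in> V" for v
    using that by (auto simp: B_def not_le)
  define \<psi> where "\<psi> v b = (SOME \<psi>. W v b \<psi>)" for v b
  have "\<exists>\<psi>. W v b \<psi>" if "b \<in> B v" for v b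
    using that unfolding B_def W_def robust_def by blast
  then have \<psi>: "W v b (\<psi> v b)" if "b \<in> B v" for v b
    unfolding \<psi>_def using that by (metis someI_ex)
  have "finite (\<psi> v b ` V) \<and> card (\<psi> v b ` V) \<le> card V" for v b
    using finite_V card_image_le by blast
  from ex_transversal_avoiding[of V B "\<lambda>v b. \<psi> v b ` V", OF finite_V large this]
  obtain \<phi> where \<phi>: "\<phi> \<in> PiE V B"
    and avoid: "\<forall>v\<in>V. \<forall>x\<in>V. x \<noteq> v \<longrightarrow> \<phi> x \<notin> \<psi> v (\<phi> v) ` V"
    by blast
  have \<phi>_range: "\<phi> \<in> V \<rightarrow> {1..c}" using \<phi> by (auto simp: B_def)
  then obtain v where v: "v \<in> V" "\<Psi> (fibre_const \<phi>) = \<phi> v"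
    using \<Psi>_fibre_const_in_image by blast
  have "\<phi> v \<in> B v" using \<phi> v(1) by (rule PiE_mem)
  note \<psi>_v = \<psi>[OF this, unfolded W_def]
  have "\<psi> v (\<phi> v) \<in> V \<rightarrow> {1..c}" "\<Psi> (fibre_const \<phi>) = \<Psi> (fibre_const (\<psi> v (\<phi> v)))"
    using \<psi>_v v(2) by auto
  then obtain x y where "x \<in> V" "y \<in> V" "y = x \<or> E x y" "\<phi> x = \<psi> v (\<phi> v) y"
    by (rule \<Psi>_fibre_const_eq_imp[OF \<phi>_range])
  then show False
    using avoid v(1) \<psi>_v by (cases "x = v") auto
qed

lemma girth_ge_6_imp_False:
  assumes girth: "girth V E \<ge> 6" and irrefl: "\<And>x. x \<in> V \<Longrightarrow> \<not> E x x"
    and c: "c = 4 * q + 2" and q: "card V ^ 3 \<le> q"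
  shows False
proof -
  let ?F = "lex_Kq_vertices V q"
  obtain v where v: "v \<in> V" and few: "card {b \<in> {1..c}. \<not> robust v b} \<le> card V ^ 3"
    using ex_vertex_few_nonrobust by blast
  define N1 where "N1 = {u \<in> V. E v u}"
  define N02 where "N02 = {u \<in> V. u \<notin> N1 \<and> (u = v \<or> (\<exists>w\<in>N1. E w u))}"
  have v_N1: "v \<notin> N1" using irrefl v by (simp add: N1_def)
  have indep1: "\<not> E a b" if "a \<in> N1" "b \<in> N1" for a b
  proof
    assume ab: "E a b"
    have "a \<in> V" "b \<in> V" "E v a" "E b v" using that E_sym v by (auto simp: N1_def)
    moreover from this ab have "distinct [v, a, b]" using irrefl v by auto
    ultimately show False
      using girth_no_triangle[OF girth, of v a b] ab v by simp
  qed
  have indep02: "\<not> E a b" if ab_in: "a \<in> N02" "b \<in> N02" for a b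
  proof
    assume ab: "E a b"
    have V: "a \<in> V" "b \<in> V" and nE: "\<not> E v a" "\<not> E v b"
      using that by (auto simp: N02_def N1_def)
    \<comment> \<open>All neighbours of v lie in \<open>N1\<close>, so both ends have distance 2
      from v.\<close>
    then have ab_ne: "a \<noteq> v" "b \<noteq> v" "a \<noteq> b" using ab E_sym v irrefl by blast+
    obtain a' where a': "a' \<in> V" "E v a'" "E a' a"
      using ab_in ab_ne by (auto simp: N02_def N1_def)
    obtain b' where b': "b' \<in> V" "E v b'" "E b' b"
      using ab_in ab_ne by (auto simp: N02_def N1_def)
    have ne: "a' \<noteq> v" "b' \<noteq> v" "a' \<noteq> a" "a' \<noteq> b" "b' \<noteq> a" "b' \<noteq> b"
      using a' b' nE irrefl v by auto
    have closing: "E b b'" "E b' v" using E_sym b' V v by blast+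
    \<comment> \<open>The paths v a' a and v b' b together with ab contain a triangle if a' = b' and
      form a pentagon otherwise.\<close>
    show False
    proof (cases "a' = b'")
      case True
      then show False
        using girth_no_triangle[OF girth, of a' a b] a' b' ab V ne ab_ne closing by simp
    next
      case False
      then show False
        using girth_no_pentagon[OF girth, of v a' a b b'] a' b' ab V ne v ab_ne closing by simp
    qed
  qed
  define \<mu> where "\<mu> t = (\<lambda>(x, i)\<in>?F. if x \<in> N02 then i else if x \<in> N1 then q + i else t)" for t
  have \<mu>_exp: "\<mu> t \<in> exp_vertices c ?F" if "t \<in> {2 * q<..c}" for t
    using that by (auto simp: \<mu>_def exp_vertices_def lex_Kq_vertices_def c)
  have clique: "exp_edge ?F (lex_Kq_edge E) (\<mu> s) (\<mu> t)"
    if "s \<in> {2 * q<..c}" "t \<in> {2 * q<..c}" "s \<noteq> t" for s t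
  proof -
    \<comment> \<open>The three regions use disjoint colour blocks: up to q, from q + 1 to 2q, and
      above 2q. In the first two, independence confines edges to a single fibre, where the indices
      differ; in the third the values are s' and t'.\<close>
    have "\<mu> s' y \<noteq> \<mu> t' z" if "y \<in> ?F" "z \<in> ?F" "lex_Kq_edge E y z"
      "s' \<in> {2 * q<..c}" "t' \<in> {2 * q<..c}" "s' \<noteq> t'" for s' t' y z
      using that indep1 indep02
      by (cases y; cases z) (auto simp: \<mu>_def lex_Kq_vertices_def lex_Kq_edge_def)
    then show ?thesis using that unfolding exp_edge_def by metis
  qed
  have inj: "inj_on (\<lambda>t. \<Psi> (\<mu> t)) {2 * q<..c}"
  proof (rule inj_onI, rule ccontr)
    fix s t assume st: "s \<in> {2 * q<..c}" "t \<in> {2 * q<..c}" "\<Psi> (\<mu> s) = \<Psi> (\<mu> t)" "s \<noteq> t"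
    from \<Psi>_proper[OF \<mu>_exp[OF st(1)] \<mu>_exp[OF st(2)] clique[OF st(1,2,4)]] st(3)
    show False by simp
  qed
  have "\<exists>t\<in>{2 * q<..c}. \<Psi> (\<mu> t) = t"
  proof (rule ccontr)
    assume "\<not> ?thesis"
    then have ne: "\<Psi> (\<mu> t) \<noteq> t" if "t \<in> {2 * q<..c}" for t using that by blast
    \<comment> \<open>Pigeonhole: 2q + 2 maps of distinct colours would share 2q colours.\<close>
    have "\<Psi> (\<mu> t) \<in> {1..2 * q}" if "t \<in> {2 * q<..c}" for t
      using \<Psi>_in_image[OF \<mu>_exp[OF that]] ne[OF that]
      by (auto simp: \<mu>_def lex_Kq_vertices_def split: if_splits)
    then have "card {2 * q<..c} \<le> card {1..2 * q}"
      using inj by (intro card_inj_on_le) auto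
    then show False by (simp add: c)
  qed
  then obtain t where t: "t \<in> {2 * q<..c}" "\<Psi> (\<mu> t) = t" by blast
  have "\<exists>z\<in>{2 * q<..c}. z \<noteq> t \<and> robust v z"
  proof (rule ccontr)
    assume "\<not> ?thesis"
    \<comment> \<open>The left side has 2q + 1 elements, the right side at most p^3 \<le> q.\<close>
    then have "{2 * q<..c} - {t} \<subseteq> {b \<in> {1..c}. \<not> robust v b}" by auto
    then have "card ({2 * q<..c} - {t}) \<le> card {b \<in> {1..c}. \<not> robust v b}"
      by (intro card_mono) auto
    then show False using few q t by (simp add: c)
  qed
  then obtain z where z: "z \<in> {2 * q<..c}" "z \<noteq> t" "robust v z" by blast
  define \<phi> where "\<phi> x = (if x = v \<or> x \<in> N1 then t else z)" for x
  have \<phi>_range: "\<phi> \<in> V \<rightarrow> {1..c}" using t z by (auto simp: \<phi>_def)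
  have "\<Psi> (fibre_const \<phi>) \<noteq> z"
    using z \<phi>_range unfolding robust_def \<phi>_def N1_def by fastforce
  then have "\<Psi> (fibre_const \<phi>) = t"
    using \<Psi>_fibre_const_in_image[OF \<phi>_range] by (auto simp: \<phi>_def split: if_splits)
  moreover have "exp_edge ?F (lex_Kq_edge E) (fibre_const \<phi>) (\<mu> t)"
  proof -
    \<comment> \<open>Over N[v], \<phi> is t, and neighbours stay within distance 2, where
      \<open>\<mu> t\<close> is at most 2q < t. Elsewhere \<phi> is z, which is not a value of
      \<open>\<mu> t\<close>.\<close>
    have ne: "\<phi> x \<noteq> \<mu> t (y, j)" if "x \<in> V" "(y, j) \<in> ?F" "x = y \<or> E x y" for x y j
    proof (cases "x = v \<or> x \<in> N1")
      case True
      then have "y \<in> N02 \<or> y \<in> N1"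
        using that v v_N1 by (auto simp: N02_def N1_def lex_Kq_vertices_def)
      then show ?thesis
        using t True that(2) by (auto simp: \<phi>_def \<mu>_def lex_Kq_vertices_def)
    next
      case False
      then show ?thesis
        using z that(2) by (auto simp: \<phi>_def \<mu>_def lex_Kq_vertices_def)
    qed
    have "fibre_const \<phi> a \<noteq> \<mu> t b \<and> fibre_const \<phi> b \<noteq> \<mu> t a"
      if ab: "a \<in> ?F" "b \<in> ?F" "lex_Kq_edge E a b" for a b
    proof -
      obtain x i y j where "a = (x, i)" "b = (y, j)" by (meson surj_pair)
      then show ?thesis
        using ab ne[of x y j] ne[of y x i] E_sym[of x y]
        by (auto simp: fibre_const_def lex_Kq_edge_def lex_Kq_vertices_def)
    qed
    then show ?thesis by (simp add: exp_edge_def)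
  qed
  ultimately show False
    using \<Psi>_proper[OF fibre_const_in_exp_vertices[OF \<phi>_range] \<mu>_exp[OF t(1)]] t(2) by simp
qed

end

section \<open>Normalisation and conclusion\<close>

lemma ex_normalised_exp_colouring:
  assumes "simple_graph V E"
    and "colourable (exp_vertices c (lex_Kq_vertices V q))
      (exp_edge (lex_Kq_vertices V q) (lex_Kq_edge E)) c"
  shows "\<exists>\<Psi>. normalised_exp_colouring V E q c \<Psi>"
proof -
  let ?F = "lex_Kq_vertices V q"
  let ?k = "\<lambda>i. \<lambda>z\<in>?F. i"
  obtain h where range: "\<And>f. f \<in> exp_vertices c ?F \<Longrightarrow> h f \<in> {1..c}"
    and proper: "\<And>f g. f \<in> exp_vertices c ?F \<Longrightarrow> g \<in> exp_vertices c ?F \<Longrightarrow>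
      exp_edge ?F (lex_Kq_edge E) f g \<Longrightarrow> h f \<noteq> h g"
    using assms(2) unfolding colourable_def by blast
  have k: "?k i \<in> exp_vertices c ?F" if "i \<in> {1..c}" for i
    using that by (simp add: exp_vertices_def)
  have inj: "inj_on (\<lambda>i. h (?k i)) {1..c}"
  proof (rule inj_onI, rule ccontr)
    fix i j assume ij: "i \<in> {1..c}" "j \<in> {1..c}" "h (?k i) = h (?k j)" "i \<noteq> j"
    then have "exp_edge ?F (lex_Kq_edge E) (?k i) (?k j)" by (simp add: exp_edge_def)
    with proper k ij show False by blast
  qed
  \<comment> \<open>The c constant maps use every colour once; composing h with the inverse of this
    permutation normalises it.\<close>
  have "(\<lambda>i. h (?k i)) ` {1..c} = {1..c}"
    using range k by (intro endo_inj_surj inj) blast+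
  with inj have bij: "bij_betw (\<lambda>i. h (?k i)) {1..c} {1..c}" by (simp add: bij_betw_def)
  define \<sigma> where "\<sigma> = the_inv_into {1..c} (\<lambda>i. h (?k i))"
  have \<sigma>: "bij_betw \<sigma> {1..c} {1..c}"
    unfolding \<sigma>_def using bij by (rule bij_betw_the_inv_into)
  have "normalised_exp_colouring V E q c (\<lambda>f. \<sigma> (h f))"
  proof
    show "finite V" "\<And>x y. x \<in> V \<Longrightarrow> y \<in> V \<Longrightarrow> E x y \<Longrightarrow> E y x"
      using assms(1) by (auto simp: simple_graph_def)
    show "\<sigma> (h f) \<in> {1..c}" if "f \<in> exp_vertices c ?F" for f
      using \<sigma> range[OF that] by (rule bij_betwE[rule_format])
    show "\<sigma> (h f) \<noteq> \<sigma> (h g)" if "f \<in> exp_vertices c ?F" "g \<in> exp_vertices c ?F"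
      "exp_edge ?F (lex_Kq_edge E) f g" for f g
      using proper[OF that] range that \<sigma> by (metis bij_betw_def inj_on_eq_iff)
    show "\<sigma> (h (?k i)) = i" if "i \<in> {1..c}" for i
      unfolding \<sigma>_def using the_inv_into_f_f[OF inj that] .
  qed
  then show ?thesis by blast
qed

theorem theorem1:
  fixes V :: "'a set" and E :: "'a \<Rightarrow> 'a \<Rightarrow> bool" and p q c :: nat
  assumes "simple_graph V E" and "V \<noteq> {}"
    and "card V = p"
    and "real (independence_number V E) \<le> real p / 4.1"
    and "girth V E \<ge> 6"
    and "q \<ge> 2 ^ (p - 1) * p ^ 2"
    and "c = 4 * q + 2"
  shows "chromatic_number (lex_Kq_vertices V q) (lex_Kq_edge E) > enat c
       \<and> chromatic_number (exp_vertices c (lex_Kq_vertices V q))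
           (exp_edge (lex_Kq_vertices V q) (lex_Kq_edge E)) > enat c"
proof -
  have fin: "finite V" and irrefl: "\<And>x. x \<in> V \<Longrightarrow> \<not> E x x"
    using assms(1) by (auto simp: simple_graph_def)
  have p_pos: "p > 0" using fin assms(2,3) by auto
  \<comment> \<open>This turns the bound on q into p^3 \<le> q, matching the number of nonrobust
    colours.\<close>
  have "p - 1 < 2 ^ (p - 1)" by (rule less_exp)
  then have "p \<le> 2 ^ (p - 1)" by linarith
  then have "p * p ^ 2 \<le> 2 ^ (p - 1) * p ^ 2" by (rule mult_le_mono1)
  then have q_cube: "p ^ 3 \<le> q"
    using assms(6) by (simp only: power3_eq_cube power2_eq_square mult.assoc)
  \<comment> \<open>A single vertex is independent, so p \<ge> 4.1, hence p \<ge> 5 and q \<ge>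
    125.\<close>
  obtain v where "v \<in> V" using assms(2) by blast
  then have "independent_set V E {v}" using irrefl by (simp add: independent_set_def)
  from card_independent_set_le[OF fin this] have "1 \<le> real (independence_number V E)" by simp
  with assms(4) have "real p \<ge> 4.1" by simp
  then have "p \<ge> 5" by linarith
  then have "5 ^ 3 \<le> p ^ 3" by (rule power_mono) simp
  with q_cube have q_large: "q > 20" by simp
  have "\<not> colourable (lex_Kq_vertices V q) (lex_Kq_edge E) c"
  proof
    assume "colourable (lex_Kq_vertices V q) (lex_Kq_edge E) c"
    from colourable_lex_Kq_imp_le[OF fin this]
    have "real p * real q \<le> real c * real (independence_number V E)"
      using assms(3) by (metis of_nat_le_iff of_nat_mult)
    also have "\<dots> \<le> real c * (real p / 4.1)"
      using assms(4) by (rule mult_left_mono) simp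
    finally have "real p * (4.1 * real q) \<le> real p * real c" by (simp add: field_simps)
    then have "4.1 * real q \<le> real c" using p_pos by simp
    \<comment> \<open>4.1q > 4q + 2 holds exactly when q > 20.\<close>
    then show False using q_large assms(7) by simp
  qed
  moreover have "\<not> colourable (exp_vertices c (lex_Kq_vertices V q))
      (exp_edge (lex_Kq_vertices V q) (lex_Kq_edge E)) c"
  proof
    assume "colourable (exp_vertices c (lex_Kq_vertices V q))
      (exp_edge (lex_Kq_vertices V q) (lex_Kq_edge E)) c"
    then obtain \<Psi> where "normalised_exp_colouring V E q c \<Psi>"
      using ex_normalised_exp_colouring[OF assms(1)] by blast
    from normalised_exp_colouring.girth_ge_6_imp_False[OF this assms(5) irrefl assms(7)]
    show False using q_cube assms(3) by blast
  qed
  ultimately show ?thesis by (simp add: less_chromatic_numberI)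
qed

end
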